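(* Let $N$ be a friend of $10$. Then $N$ has at least $7$ distinct prime factors. Further, there exist prime factors $p$ and $q$ of $N$ (not necessarily distinct) such that $p\equiv 1 \pmod{10}$ and $q\equiv 1 \pmod 6$.
   Context: For a positive integer $n$, $\sigma(n)$ denotes the sum of the positive divisors of $n$ and $I(n)=\sigma(n)/n$ is its abundancy index. A positive integer $N>10$ is called a friend of $10$ if $I(N)=I(10)=9/5$. *)

theory Defs
  imports Complex_Main "HOL-Number_Theory.Number_Theory"
begin

definition divisor_sum :: "nat \<Rightarrow> nat" where
  "divisor_sum n = (\<Sum>d | d dvd n. d)"

definition abundancy_index :: "nat \<Rightarrow> real" where
  "abundancy_index n = real (divisor_sum n) / real n"

definition friend_of_10 :: "nat \<Rightarrow> bool" where
  "friend_of_10 N \<longleftrightarrow> N > 10 \<and> abundancy_index N = abundancy_index 10"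

lemma abundancy_index_10: "abundancy_index 10 = 9 / 5"
proof -
  have "{d. d dvd (10::nat)} = {1, 2, 5, 10}"
  proof (intro equalityI subsetI)
    fix d :: nat
    assume "d \<in> {d. d dvd 10}"
    then have d: "d dvd 10" by simp
    then have "d \<le> 10" by (rule dvd_imp_le) simp
    then have "d = 0 \<or> d = 1 \<or> d = 2 \<or> d = 3 \<or> d = 4 \<or> d = 5 \<or> d = 6 \<or> d = 7 \<or> d = 8 \<or> d = 9 \<or> d = 10"
      by presburger
    then show "d \<in> {1, 2, 5, 10}" using d by (elim disjE) simp_all
  qed auto
  then show ?thesis by (simp add: abundancy_index_def divisor_sum_def)
qed

end

theory Submission
  imports Defs
begin

text \<open>
  Write \<open>N = \<Prod> p ^ e\<close>. Since \<open>10\<close> does not divide \<open>N\<close>, all exponents are even, and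
  \<open>5 \<sigma>(N) = 9 N\<close> forces \<open>5\<close> and \<open>3\<close> to divide \<open>\<sigma>(N) = \<Prod> (1 + p + \<dots> + p ^ e)\<close>. A prime
  \<open>l \<in> {3, 5}\<close> divides such a factor only if \<open>p = 1\<close> modulo \<open>l\<close> and \<open>l\<close> divides \<open>e + 1\<close>: the order
  of \<open>p\<close> modulo \<open>l\<close> is a power of \<open>2\<close> dividing the odd number \<open>e + 1\<close>. This yields the two congruences,
  and moreover a prime \<open>q\<close> such that \<open>\<Phi>(q) = 1 + q + q\<^sup>2 + q\<^sup>3 + q\<^sup>4\<close> divides \<open>\<sigma>(N)\<close>. All prime
  factors of \<open>\<Phi>(q)\<close> other than \<open>5\<close> are again \<open>1\<close> modulo \<open>10\<close> and divide \<open>N\<close>, so \<open>N\<close> has at least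
  two prime factors \<open>1\<close> modulo \<open>10\<close>; counting the factors \<open>5\<close> of \<open>\<sigma>(N)\<close> yields a third one.

  If \<open>N\<close> had at most six prime factors, then \<open>9/5 \<le> \<Prod> p / (p - 1)\<close> would leave only
  \<open>5, 7, 11, y, z, w\<close> with \<open>y \<in> {31, 41}\<close>, \<open>z \<le> 421\<close> and \<open>w < 18\<close>, where \<open>11, y, z\<close> are the primes
  \<open>1\<close> modulo \<open>10\<close>. For each such \<open>y, z\<close> and each \<open>q \<in> {11, y, z}\<close>, however, \<open>\<Phi>(q)\<close> has a prime
  factor outside \<open>{5, 11, y, z}\<close>.
\<close>

section \<open>Geometric sums and their prime divisors\<close>

definition geo :: "nat \<Rightarrow> nat \<Rightarrow> nat" where
  "geo x n = (\<Sum>i<n. x ^ i)"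

text \<open>The exponents below \<open>m * n\<close> split into \<open>n\<close> consecutive blocks
  of length \<open>m\<close>.\<close>

lemma geo_mult: "geo x (m * n) = geo x m * geo (x ^ m) n"
proof -
  have "(\<Sum>i = j * m..<j * m + m. x ^ i) = x ^ (m * j) * geo x m" for j
  proof -
    have "(\<Sum>i = j * m..<j * m + m. x ^ i) = (\<Sum>i = 0..<m. x ^ (i + j * m))"
      using sum.shift_bounds_nat_ivl[of "\<lambda>i. x ^ i" 0 "j * m" m] by (simp add: add.commute)
    also have "\<dots> = x ^ (m * j) * geo x m"
      by (simp add: geo_def power_add sum_distrib_left lessThan_atLeast0 mult.commute)
    finally show ?thesis .
  qed
  then have "geo x (n * m) = (\<Sum>j<n. x ^ (m * j) * geo x m)"
    unfolding geo_def using sum.nat_group[of "\<lambda>i. x ^ i" m n] by simp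
  also have "\<dots> = geo x m * geo (x ^ m) n"
    by (simp only: geo_def[of "x ^ m"] power_mult mult.commute[of _ "geo x m"] sum_distrib_left)
  finally show ?thesis
    by (simp only: mult.commute)
qed

lemma geo_cong: "[x = y] (mod m) \<Longrightarrow> [geo x n = geo y n] (mod m)"
  unfolding geo_def by (intro cong_sum cong_pow)

lemma geo_cong_1: "[x = 1] (mod m) \<Longrightarrow> [geo x n = n] (mod m)"
  using geo_cong[of x 1 m n] by (simp add: geo_def)

lemma geo_3: "geo x 3 = 1 + x + x ^ 2"
  by (simp add: geo_def eval_nat_numeral)

lemma geo_5: "geo x 5 = 1 + x + x ^ 2 + x ^ 3 + x ^ 4"
  by (simp add: geo_def eval_nat_numeral)

lemma power_eq_geo: "x > 0 \<Longrightarrow> x ^ n = 1 + (x - 1) * geo x n"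
proof (induction n)
  case (Suc n)
  then show ?case
    by (cases x) (auto simp: geo_def algebra_simps)
qed (simp add: geo_def)

text \<open>The order of \<open>x\<close> modulo \<open>l\<close> divides \<open>n\<close>, since
  \<open>x ^ n - 1\<close> is a multiple of \<open>geo x n\<close>, and it divides
  \<open>l - 1\<close> by Fermat. These two being coprime, the order is 1, and then
  \<open>geo x n = n\<close> modulo \<open>l\<close>.\<close>

lemma prime_dvd_geo:
  assumes l: "prime l" and dvd: "l dvd geo x n" and cop: "coprime (l - 1) n" and x: "x > 0" "n > 0"
  shows "[x = 1] (mod l)" and "l dvd n"
proof -
  have "[x ^ n = 1] (mod l)"
    using dvd power_eq_geo[OF x(1), of n] by (metis cong_0_iff cong_add_lcancel_0_nat dvd_mult)
  then have "ord l x dvd n"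
    unfolding ord_divides .
  moreover have "\<not> l dvd x"
  proof
    assume "l dvd x"
    then have "[geo x n = geo 0 n] (mod l)"
      by (intro geo_cong) (simp add: cong_0_iff)
    \<comment> \<open>Only the term \<open>0 ^ 0 = 1\<close> survives; it is present because
      \<open>n > 0\<close>.\<close>
    moreover have "geo 0 n = 1"
      using x(2) by (cases n) (auto simp: geo_def sum.lessThan_Suc_shift simp del: sum.lessThan_Suc)
    ultimately show False
      using dvd l by (metis cong_dvd_iff nat_dvd_1_iff_1 not_prime_1)
  qed
  then have "[x ^ (l - 1) = 1] (mod l)"
    by (rule fermat_theorem[OF l])
  then have "ord l x dvd (l - 1)"
    unfolding ord_divides .
  ultimately have "ord l x = 1"
    using cop by (metis coprime_common_divisor_nat)
  then show cong: "[x = 1] (mod l)"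
    by (simp add: ord_eq_Suc_0_iff)
  show "l dvd n"
    using dvd geo_cong_1[OF cong, of n] by (simp add: cong_dvd_iff)
qed

text \<open>Otherwise \<open>r - 1\<close> is coprime to 5, and \<open>prime_dvd_geo\<close> makes
  \<open>r\<close> divide 5.\<close>

lemma prime_dvd_geo_5:
  assumes r: "prime r" and dvd: "r dvd geo x 5" and "r \<noteq> 5" "x > 0"
  shows "[r = 1] (mod 5)"
proof -
  have "5 dvd r - 1"
  proof (rule ccontr)
    assume "\<not> 5 dvd r - 1"
    then have "coprime (r - 1) 5"
      using prime_imp_coprime[of 5 "r - 1"] by (simp add: coprime_commute)
    then have "r dvd 5"
      using prime_dvd_geo(2)[OF r dvd] assms by simp
    then show False
      using r \<open>r \<noteq> 5\<close> primes_dvd_imp_eq[of r 5] by auto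
  qed
  then show ?thesis
    using prime_ge_1_nat[OF r] by (subst cong_altdef_nat) auto
qed

text \<open>Putting \<open>x = 5 * k + 1\<close> shows that the sum is 5 modulo 25, so 5 divides it
  exactly once.\<close>

lemma geo_5_eq_5_mult:
  assumes "[x = 1] (mod 5)"
  obtains u where "geo x 5 = 5 * u" "\<not> 5 dvd u"
proof -
  have "x mod 5 = 1"
    using assms by (simp add: cong_def)
  then have "x = 5 * (x div 5) + 1"
    by presburger
  then obtain k where k: "x = 5 * k + 1" ..
  have "geo x 5 = 5 * (5 * (2 * k + 10 * k ^ 2 + 25 * k ^ 3 + 25 * k ^ 4) + 1)"
    unfolding k by (simp add: geo_5 power2_eq_square power3_eq_cube power4_eq_xxxx algebra_simps)
  moreover have "\<not> 5 dvd 5 * m + 1" for m :: nat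
    by presburger
  ultimately show thesis
    by (rule that)
qed

text \<open>The sum exceeds 5 but contains the factor 5 only once, so another prime divides
  it.\<close>

lemma ex_prime_dvd_geo_5:
  assumes x: "[x = 1] (mod 5)" "x > 1"
  shows "\<exists>r. prime r \<and> r dvd geo x 5 \<and> r \<noteq> 5 \<and> [r = 1] (mod 5)"
proof -
  obtain u where u: "geo x 5 = 5 * u" "\<not> 5 dvd u"
    using geo_5_eq_5_mult[OF x(1)] .
  have "geo x 5 > 5"
    using x(2) power_mono[of 2 x 2] by (simp add: geo_5)
  then have "u \<noteq> 1"
    using u by auto
  then obtain r where r: "prime r" "r dvd u"
    using prime_factor_nat by blast
  then have "r dvd geo x 5" "r \<noteq> 5"
    using u by auto
  then show ?thesis
    using prime_dvd_geo_5[of r x] r x by auto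
qed

section \<open>The divisor sum as a product over prime powers\<close>

lemma divisor_sum_mult:
  assumes "coprime a b"
  shows "divisor_sum (a * b) = divisor_sum a * divisor_sum b"
proof -
  let ?D = "\<lambda>n. {d::nat. d dvd n}"
  have "inj_on (\<lambda>(x, y). x * y) (?D a \<times> ?D b)"
  proof (rule inj_onI, clarsimp)
    fix x y x' y' assume *: "x dvd a" "y dvd b" "x' dvd a" "y' dvd b" "x * y = x' * y'"
    have "coprime x y'" "coprime x' y" "coprime x y" "coprime x' y'"
      using * assms by (meson coprime_divisors)+
    then have "x dvd x'" "x' dvd x" "y dvd y'" "y' dvd y"
      using *(5) by (metis coprime_commute coprime_dvd_mult_left_iff coprime_dvd_mult_right_iff dvd_triv_left dvd_triv_right)+
    then show "x = x' \<and> y = y'"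
      by (simp add: dvd_antisym)
  qed
  moreover have "(\<lambda>(x, y). x * y) ` (?D a \<times> ?D b) = ?D (a * b)"
  proof (intro equalityI subsetI)
    fix d assume "d \<in> ?D (a * b)"
    then obtain x y where "d = x * y" "x dvd a" "y dvd b"
      using division_decomp[of d a b] by auto
    then show "d \<in> (\<lambda>(x, y). x * y) ` (?D a \<times> ?D b)"
      by auto
  qed (auto intro: mult_dvd_mono)
  ultimately have "divisor_sum (a * b) = (\<Sum>(x, y)\<in>?D a \<times> ?D b. x * y)"
    unfolding divisor_sum_def
    by (metis (mono_tags, lifting) sum.reindex_cong prod.case_distrib case_prod_beta')
  then show ?thesis
    by (simp add: divisor_sum_def sum_product sum.cartesian_product)
qed

lemma divisor_sum_prime_power:
  assumes "prime p"
  shows "divisor_sum (p ^ k) = geo p (Suc k)"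
proof -
  have "{d. d dvd p ^ k} = (\<lambda>i. p ^ i) ` {..<Suc k}"
    using divides_primepow_nat[OF assms] by (auto simp: less_Suc_eq_le)
  moreover have "inj_on (\<lambda>i. p ^ i) {..<Suc k}"
    using prime_gt_1_nat[OF assms] by (auto intro!: inj_onI dest: power_inject_exp)
  ultimately show ?thesis
    by (simp add: divisor_sum_def geo_def sum.reindex del: sum.lessThan_Suc)
qed

lemma divisor_sum_prod_prime_powers:
  assumes "finite S" "\<And>p. p \<in> S \<Longrightarrow> prime p"
  shows "divisor_sum (\<Prod>p\<in>S. p ^ e p) = (\<Prod>p\<in>S. geo p (Suc (e p)))"
  using assms
proof (induction S rule: finite_induct)
  case empty
  have "{d::nat. d dvd 1} = {1}" by auto
  then show ?case by (simp add: divisor_sum_def)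
next
  case (insert p S)
  have "coprime (p ^ e p) (\<Prod>p\<in>S. p ^ e p)"
    using insert by (intro prod_coprime_right) (metis coprime_power_left_iff coprime_power_right_iff insertCI primes_coprime)
  then show ?case
    using insert by (simp add: divisor_sum_mult divisor_sum_prime_power)
qed

lemma divisor_sum_eq_prod:
  assumes "n > 0"
  shows "divisor_sum n = (\<Prod>p\<in>prime_factors n. geo p (Suc (multiplicity p n)))"
  using divisor_sum_prod_prime_powers[of "prime_factors n" "\<lambda>p. multiplicity p n"] assms
    prime_factorization_nat[of n] by (simp add: in_prime_factors_iff)

section \<open>Comparison of products and bounds for the abundancy index\<close>

text \<open>After cancelling the common factors, each factor left from \<open>S\<close> is at most
  \<open>f (Max T)\<close>, each one left from \<open>T\<close> is at least that, and
  \<open>T\<close> has no fewer of them. This serves to replace unknown primes by the smallest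
  admissible ones.\<close>

lemma prod_le_prod_of_card_le:
  fixes f :: "nat \<Rightarrow> real"
  assumes fin: "finite S" "finite T" and card: "card S \<le> card T"
    and le: "\<And>x y. x \<in> S - T \<Longrightarrow> y \<in> T \<Longrightarrow> y \<le> x"
    and mono: "\<And>x y. y \<in> S \<union> T \<Longrightarrow> y \<le> x \<Longrightarrow> f x \<le> f y"
    and ge: "\<And>x. x \<in> S \<union> T \<Longrightarrow> 1 \<le> f x"
  shows "prod f S \<le> prod f T"
proof (cases "T = {}")
  case True
  then show ?thesis using card fin by auto
next
  case False
  define c where "c = f (Max T)"
  have M: "Max T \<in> T" using False fin by auto
  have c: "c \<ge> 1" unfolding c_def using M ge by auto
  have cd: "card (S - T) \<le> card (T - S)"
    using card fin by (metis card_le_sym_Diff)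
  have nonneg: "0 \<le> f x" if "x \<in> S \<union> T" for x
    using ge[OF that] by linarith
  have le_c: "f x \<le> c" if "x \<in> S - T" for x
    using that le M unfolding c_def by (intro mono) auto
  have "prod f (S - T) \<le> (\<Prod>x\<in>S - T. c)"
    using nonneg le_c by (intro prod_mono) auto
  also have "\<dots> \<le> (\<Prod>x\<in>T - S. c)"
    using cd c by (simp add: power_increasing)
  also have "\<dots> \<le> prod f (T - S)"
    using mono M c fin by (intro prod_mono) (auto simp: c_def)
  finally have *: "prod f (S - T) \<le> prod f (T - S)" .
  have "prod f S = prod f (S \<inter> T) * prod f (S - T)"
    by (rule prod.Int_Diff[OF fin(1)])
  also have "\<dots> \<le> prod f (S \<inter> T) * prod f (T - S)"
    using * nonneg by (intro mult_left_mono prod_nonneg) auto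
  also have "\<dots> = prod f T"
    using prod.Int_Diff[OF fin(2), of f S] by (simp add: Int_commute)
  finally show ?thesis .
qed

text \<open>Multiplication by \<open>k = N / a\<close> embeds the divisors of \<open>a\<close> in
  those of \<open>N\<close>, which gives \<open>I(a) \<le> I(N)\<close>, written here without
  denominators. If \<open>k > 1\<close>, the divisor 1 of \<open>N\<close> is missed and the
  inequality is strict.\<close>

lemma divisor_sum_dvd:
  assumes "a dvd N" "N > 0"
  shows "divisor_sum a * N \<le> divisor_sum N * a"
    and "a < N \<Longrightarrow> divisor_sum a * N < divisor_sum N * a"
proof -
  obtain k where N: "N = a * k"
    using assms(1) by blast
  have pos: "a > 0" "k > 0"
    using assms(2) unfolding N by auto
  let ?A = "(\<lambda>d. d * k) ` {d. d dvd a}" and ?B = "{d. d dvd N}"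
  have fin: "finite ?B"
    using assms(2) by simp
  have sub: "?A \<subseteq> ?B"
    unfolding N by (intro image_subsetI CollectI mult_dvd_mono) simp_all
  have "inj_on (\<lambda>d. d * k) {d. d dvd a}"
    using pos(2) by (intro inj_onI) simp
  then have eq: "divisor_sum a * k = \<Sum>?A"
    unfolding divisor_sum_def sum_distrib_right by (simp add: sum.reindex)
  have "\<Sum>?A \<le> divisor_sum N"
    unfolding divisor_sum_def using fin sub by (rule sum_mono2) simp
  then have "(divisor_sum a * k) * a \<le> divisor_sum N * a"
    unfolding eq by (rule mult_le_mono1)
  then show "divisor_sum a * N \<le> divisor_sum N * a"
    by (simp only: N ac_simps)
  show "divisor_sum a * N < divisor_sum N * a" if "a < N"
  proof -
    have "k \<noteq> 1"
      using that unfolding N by auto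
    then have "d * k \<noteq> 1" for d
      by (simp only: nat_mult_eq_1_iff simp_thms)
    then have "1 \<in> ?B - ?A"
      by (metis (no_types, lifting) DiffI imageE mem_Collect_eq one_dvd)
    then have "\<Sum>?A < divisor_sum N"
      unfolding divisor_sum_def using fin sub by (intro sum_strict_mono2[where b = 1]) simp_all
    then have "(divisor_sum a * k) * a < divisor_sum N * a"
      unfolding eq using pos(1) by (rule mult_strict_right_mono)
    then show ?thesis
      by (simp only: N ac_simps)
  qed
qed

text \<open>The limit of \<open>I(p ^ e)\<close> as \<open>e\<close> grows.\<close>

definition euler_factor :: "nat \<Rightarrow> real" where
  "euler_factor p = real p / (real p - 1)"

lemma euler_factor_mono: "1 < p \<Longrightarrow> p \<le> q \<Longrightarrow> euler_factor q \<le> euler_factor p"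
  by (simp add: euler_factor_def field_simps)

lemma euler_factor_ge_1: "1 < p \<Longrightarrow> 1 \<le> euler_factor p"
  by (simp add: euler_factor_def field_simps)

lemma euler_factor_pos: "1 < p \<Longrightarrow> 0 < euler_factor p"
  by (simp add: euler_factor_def)

lemma geo_le_euler_factor:
  assumes "1 < p"
  shows "real (geo p (Suc e)) \<le> real (p ^ e) * euler_factor p"
proof -
  have "p ^ Suc e = 1 + (p - 1) * geo p (Suc e)"
    using assms by (intro power_eq_geo) simp
  then have "real (p ^ Suc e) = 1 + (real p - 1) * real (geo p (Suc e))"
    using assms by (metis (mono_tags, lifting) less_imp_le of_nat_1 of_nat_add of_nat_diff of_nat_mult)
  then show ?thesis
    using assms by (simp add: euler_factor_def field_simps)
qed

lemma divisor_sum_le_prod_euler_factor: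
  assumes "n > 0"
  shows "real (divisor_sum n) \<le> real n * (\<Prod>p\<in>prime_factors n. euler_factor p)"
proof -
  have "real (divisor_sum n) = (\<Prod>p\<in>prime_factors n. real (geo p (Suc (multiplicity p n))))"
    using divisor_sum_eq_prod[OF assms] by simp
  also have "\<dots> \<le> (\<Prod>p\<in>prime_factors n. real (p ^ multiplicity p n) * euler_factor p)"
    using geo_le_euler_factor prime_gt_1_nat by (intro prod_mono) (auto simp: in_prime_factors_iff)
  also have "\<dots> = real n * (\<Prod>p\<in>prime_factors n. euler_factor p)"
    using prime_factorization_nat[OF assms] by (simp only: prod.distrib flip: of_nat_prod)
  finally show ?thesis .
qed

lemma multiplicity_le_1I: "\<not> p ^ 2 dvd x \<Longrightarrow> multiplicity p (x::nat) \<le> 1"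
  using multiplicity_dvd'[of 2 p x] by linarith

section \<open>Certificates against the remaining sets of primes\<close>

text \<open>
  Each \<open>z\<close> is paired with the part of \<open>geo z 5\<close> that is prime to \<open>5\<close>, \<open>11\<close> and \<open>31\<close> (resp. \<open>41\<close>).
  Composite \<open>z\<close> are not filtered out.
\<close>

definition cofactors_31 :: "(nat \<times> nat) list" where
  "cofactors_31 =
    [(41, 579281), (51, 1380101), (61, 2815321), (71, 468631), (81, 72041), (91, 1260671),
     (101, 678071), (111, 30637421), (121, 43229041), (131, 59353061), (141, 7237771),
     (151, 104670301), (161, 135219521), (171, 5548811), (181, 19622651), (191, 24324871),
     (201, 29825491), (211, 398311621), (221, 15459911), (231, 571955261), (241, 677491681),
     (251, 6586781), (261, 931663721), (271, 1082711341), (281, 40368431), (291, 130829071),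
     (301, 149743691), (311, 170638711), (321, 2130125441), (331, 2407997461), (341, 2712207881),
     (351, 3044370701), (361, 309649811), (371, 3799249541), (381, 4225433561), (391, 4686505981),
     (401, 471301891), (411, 16776481), (421, 572530331)]"

definition cofactors_41 :: "(nat \<times> nat) list" where
  "cofactors_41 =
    [(51, 821), (61, 2815321), (71, 468631), (81, 72041), (91, 1260671)]"

text \<open>When 11, \<open>y\<close> and \<open>z\<close> are the only prime factors of
  \<open>N\<close> that are 1 modulo 10, such a \<open>v\<close> prevents \<open>geo q 5\<close>
  from dividing \<sigma>(N): any prime factor of \<open>v\<close> would be a further one. It may be
  composite.\<close>

definition excludes :: "nat \<Rightarrow> nat \<Rightarrow> nat \<Rightarrow> nat \<Rightarrow> bool" where
  "excludes y z q v \<longleftrightarrow> 1 < v \<and> v dvd geo q 5 \<and>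
    \<not> 5 dvd v \<and> \<not> 11 dvd v \<and> \<not> y dvd v \<and> \<not> z dvd v"

text \<open>\<open>geo 11 5 = 5 * 3221\<close> and \<open>geo 31 5 = 5 * 11 * 17351\<close>.\<close>

lemma excludes_31:
  "\<forall>(z, u)\<in>set cofactors_31. excludes 31 z 11 3221 \<and> excludes 31 z 31 17351 \<and> excludes 31 z z u"
  unfolding cofactors_31_def by (simp add: excludes_def geo_5)

text \<open>\<open>geo 41 5 = 5 * 579281\<close>.\<close>

lemma excludes_41:
  "\<forall>(z, u)\<in>set cofactors_41. excludes 41 z 11 3221 \<and> excludes 41 z 41 579281 \<and> excludes 41 z z u"
  unfolding cofactors_41_def by (simp add: excludes_def geo_5)

lemma obtain_two_of_card:
  fixes A :: "nat set"
  assumes "2 \<le> card A"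
  obtains y z where "y \<in> A" "z \<in> A" "y < z"
proof -
  obtain T where "T \<subseteq> A" "card T = 2"
    using obtain_subset_with_card_n[OF assms] by blast
  then obtain a b where "a \<in> A" "b \<in> A" "a \<noteq> b"
    unfolding card_2_iff by blast
  then show thesis
    using that[of a b] that[of b a] by linarith
qed

section \<open>Exponents and small prime divisors of a friend of 10\<close>

locale friend_of_ten =
  fixes N :: nat
  assumes friend: "friend_of_10 N"
begin

lemma N_gt_10: "N > 10"
  using friend by (simp add: friend_of_10_def)

lemma sigma: "5 * divisor_sum N = 9 * N"
proof -
  have "5 * real (divisor_sum N) = 9 * real N"
    using friend N_gt_10 abundancy_index_10
    by (simp add: friend_of_10_def abundancy_index_def field_simps)
  then show ?thesis by linarith
qed

lemma prime_dvd_N: "p \<in> prime_factors N \<Longrightarrow> prime p \<and> p dvd N"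
  by (simp add: in_prime_factors_iff)

lemma prime_factorsI: "prime p \<Longrightarrow> p dvd N \<Longrightarrow> p \<in> prime_factors N"
  using N_gt_10 by (simp add: in_prime_factors_iff)

lemma five_dvd: "5 dvd N"
proof -
  have "5 dvd 9 * N"
    using sigma by (metis dvd_triv_left)
  moreover have "coprime 5 (9 :: nat)"
    by (simp add: coprime_iff_gcd_eq_1 gcd_non_0_nat)
  ultimately show ?thesis
    by (simp add: coprime_dvd_mult_right_iff)
qed

lemma five_in: "5 \<in> prime_factors N"
  using five_dvd by (intro prime_factorsI) auto

text \<open>Otherwise 10 would be a proper divisor of \<open>N\<close>, forcing
  \<open>I(N) > I(10)\<close>.\<close>

lemma odd_N: "odd N"
proof
  assume "even N"
  then have "10 dvd N"
    using five_dvd by presburger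
  then have "divisor_sum 10 * N < divisor_sum N * 10"
    using N_gt_10 by (intro divisor_sum_dvd) auto
  moreover have "divisor_sum 10 = 18"
    using abundancy_index_10 by (simp add: abundancy_index_def)
  ultimately show False
    using sigma by simp
qed

lemma divisor_sum_N: "divisor_sum N = (\<Prod>p\<in>prime_factors N. geo p (Suc (multiplicity p N)))"
  using N_gt_10 by (intro divisor_sum_eq_prod) simp

lemma geo_dvd_sigma:
  "p \<in> prime_factors N \<Longrightarrow> geo p (Suc (multiplicity p N)) dvd divisor_sum N"
  unfolding divisor_sum_N by (intro dvd_prodI) auto

text \<open>The divisor sum is odd, and for odd \<open>p\<close> the sum of \<open>e + 1\<close>
  powers of \<open>p\<close> has the parity of \<open>e + 1\<close>.\<close>

lemma even_multiplicity:
  assumes p: "p \<in> prime_factors N"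
  shows "even (multiplicity p N)"
proof -
  have "odd (5 * divisor_sum N)"
    using sigma odd_N by simp
  then have "odd (geo p (Suc (multiplicity p N)))"
    using geo_dvd_sigma[OF p] by (metis dvd_trans even_mult_iff)
  moreover have "odd p"
    using prime_dvd_N[OF p] odd_N by (metis dvd_trans)
  then have "[geo p (Suc (multiplicity p N)) = Suc (multiplicity p N)] (mod 2)"
    by (intro geo_cong_1) (simp add: cong_def odd_iff_mod_2_eq_one)
  ultimately show ?thesis
    by (metis cong_dvd_iff even_Suc)
qed

lemma multiplicity_ge_2:
  assumes p: "p \<in> prime_factors N"
  shows "multiplicity p N \<ge> 2"
proof -
  have "multiplicity p N > 0"
    using p by (simp add: prime_factors_multiplicity)
  then show ?thesis
    using even_multiplicity[OF p] by presburger
qed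

lemma square_dvd: "p \<in> prime_factors N \<Longrightarrow> p ^ 2 dvd N"
  using multiplicity_ge_2 by (intro multiplicity_dvd') auto

lemma dvd_sigma_imp:
  assumes r: "prime r" "r dvd divisor_sum N" "r \<noteq> 3"
  shows "r \<in> prime_factors N"
proof -
  have "r dvd 9 * N"
    using r(2) sigma by (metis dvd_mult)
  moreover have "\<not> r dvd 9"
  proof
    assume "r dvd 9"
    then have "r dvd 3 * 3" by simp
    then have "r dvd 3"
      using r(1) prime_dvd_mult_iff by blast
    then show False
      using r primes_dvd_imp_eq[of r 3] by auto
  qed
  ultimately show ?thesis
    using r(1) prime_dvd_mult_iff by (auto intro: prime_factorsI)
qed

text \<open>No divisor of \<open>N\<close> has abundancy index above 9/5. If the exponent of 3 is at
  least 4, then \<open>3 ^ 4 * 5 ^ 2\<close> is such a divisor. If it is 2, then 13 = 1 + 3 + 9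
  divides \<sigma>(N), hence \<open>N\<close>, and \<open>3 ^ 2 * 5 ^ 2 * 13 ^ 2\<close> is
  one.\<close>

lemma three_not_dvd: "\<not> 3 dvd N"
proof
  assume "3 dvd N"
  then have three: "3 \<in> prime_factors N"
    by (intro prime_factorsI) auto
  have no: False if "a dvd N" "divisor_sum a * 5 > 9 * a" for a
  proof -
    have "divisor_sum a * N * 5 \<le> 9 * N * a"
    proof -
      have "divisor_sum a * N * 5 \<le> divisor_sum N * a * 5"
        using divisor_sum_dvd(1)[OF that(1)] N_gt_10 by simp
      also have "\<dots> = (5 * divisor_sum N) * a"
        by simp
      finally show ?thesis
        unfolding sigma .
    qed
    then have "N * (divisor_sum a * 5) \<le> N * (9 * a)"
      by (simp add: algebra_simps)
    then show False
      using that(2) N_gt_10 by simp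
  qed
  have cop: "coprime (3 ^ i) (5 ^ j :: nat)" "coprime (3 ^ i * 5 ^ j) (13 ^ k :: nat)" for i j k
    using primes_coprime[of 3 "5 :: nat"] primes_coprime[of 3 "13 :: nat"] primes_coprime[of 5 "13 :: nat"]
    by simp_all
  show False
  proof (cases "multiplicity 3 N \<ge> 3")
    case True
    then have "multiplicity 3 N \<ge> 4"
      using even_multiplicity[OF three] by presburger
    then have "3 ^ 4 dvd N"
      by (rule multiplicity_dvd')
    then have "3 ^ 4 * 5 ^ 2 dvd N"
      using square_dvd[OF five_in] cop(1) by (rule divides_mult)
    moreover have "divisor_sum (3 ^ 4 * 5 ^ 2) = 3751"
      using divisor_sum_mult[OF cop(1)[of 4 2]] divisor_sum_prime_power[of 3 4] divisor_sum_prime_power[of 5 2]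
      by (simp add: geo_3 geo_5)
    ultimately show False
      using no[of "3 ^ 4 * 5 ^ 2"] by simp
  next
    case False
    then have "multiplicity 3 N = 2"
      using multiplicity_ge_2[OF three] by simp
    then have "13 dvd divisor_sum N"
      using geo_dvd_sigma[OF three] by (simp add: geo_3)
    then have "13 \<in> prime_factors N"
      by (intro dvd_sigma_imp) auto
    then have "3 ^ 2 * 5 ^ 2 * 13 ^ 2 dvd N"
      using five_in three by (intro divides_mult cop square_dvd)
    moreover have "divisor_sum (3 ^ 2 * 5 ^ 2 * 13 ^ 2) = 73749"
      using divisor_sum_mult[OF cop(2)[of 2 2 2]] divisor_sum_mult[OF cop(1)[of 2 2]]
        divisor_sum_prime_power[of 3 2] divisor_sum_prime_power[of 5 2] divisor_sum_prime_power[of 13 2]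
      by (simp add: geo_3)
    ultimately show False
      using no[of "3 ^ 2 * 5 ^ 2 * 13 ^ 2"] by simp
  qed
qed

lemma odd_dvd: "p \<in> prime_factors N \<Longrightarrow> odd p"
  using prime_dvd_N odd_N by (metis dvd_trans)

lemma not_three_dvd: "p \<in> prime_factors N \<Longrightarrow> \<not> 3 dvd p"
  using prime_dvd_N three_not_dvd by (metis dvd_trans)

lemma gt_1: "p \<in> prime_factors N \<Longrightarrow> p > 1"
  using prime_dvd_N prime_gt_1_nat by blast

text \<open>The hypothesis on \<open>l - 1\<close>, satisfied by 3 and 5, makes it coprime to the
  odd number \<open>e + 1\<close>, as \<open>prime_dvd_geo\<close> demands.\<close>

lemma dvd_geo_imp:
  assumes l: "prime l" and pw: "l - 1 dvd 2 ^ k" and p: "p \<in> prime_factors N"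
    and dvd: "l dvd geo p (Suc (multiplicity p N))"
  shows "[p = 1] (mod l)" "l dvd Suc (multiplicity p N)"
proof -
  have "coprime (2 ^ k) (Suc (multiplicity p N))"
    using even_multiplicity[OF p] by simp
  then have "coprime (l - 1) (Suc (multiplicity p N))"
    using pw by (meson coprime_divisors dvd_refl)
  then show "[p = 1] (mod l)" "l dvd Suc (multiplicity p N)"
    using prime_dvd_geo[OF l dvd] gt_1[OF p] by simp_all
qed

lemma dvd_sigma_obtain:
  assumes l: "prime l" and pw: "l - 1 dvd 2 ^ k" and dvd: "l dvd divisor_sum N"
  obtains p where "p \<in> prime_factors N" "[p = 1] (mod l)" "l dvd Suc (multiplicity p N)"
proof -
  have "\<exists>p\<in>prime_factors N. l dvd geo p (Suc (multiplicity p N))"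
    using dvd l unfolding divisor_sum_N by (subst (asm) prime_dvd_prod_iff) auto
  then show thesis
    using dvd_geo_imp[OF l pw] that by blast
qed

lemma ex_cong_1_mod_6: "\<exists>q\<in>prime_factors N. [q = 1] (mod 6)"
proof -
  have "3 dvd divisor_sum N"
    using sigma by presburger
  then obtain p where p: "p \<in> prime_factors N" "[p = 1] (mod 3)"
    by (rule dvd_sigma_obtain[of 3 1, rotated 2]) simp_all
  have "[p = 1] (mod 6)"
    using coprime_cong_mult_nat[of p 1 2 3] p(2) odd_dvd[OF p(1)]
    by (simp add: cong_def odd_iff_mod_2_eq_one)
  with p show ?thesis by blast
qed

section \<open>Prime factors congruent to 1 modulo 10\<close>

definition P :: "nat set" where
  "P = {p \<in> prime_factors N. [p = 1] (mod 10)}"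

lemma PI: "p \<in> prime_factors N \<Longrightarrow> [p = 1] (mod 5) \<Longrightarrow> p \<in> P"
  using coprime_cong_mult_nat[of p 1 2 5] odd_dvd[of p]
  by (simp add: P_def cong_def odd_iff_mod_2_eq_one)

lemma P_cong_5: "p \<in> P \<Longrightarrow> [p = 1] (mod 5)"
  unfolding P_def using cong_dvd_modulus_nat[of p 1 10 5] by simp

lemma finite_P: "finite P"
  by (simp add: P_def)

text \<open>The primes whose factor \<open>1 + q + \<dots> + q ^ e\<close> of the divisor sum is divisible by \<open>5\<close>.\<close>

definition Q :: "nat set" where
  "Q = {q \<in> P. 5 dvd Suc (multiplicity q N)}"

lemma Q_subset_P: "Q \<subseteq> P"
  by (auto simp: Q_def)

lemma P_subset: "P \<subseteq> prime_factors N"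
  by (auto simp: P_def)

lemma twentyfive_dvd: "25 dvd N"
  using square_dvd[OF five_in] by simp

text \<open>Since 25 divides \<open>N\<close>, one factor 5 survives in \<sigma>(N) = 9 N /
  5.\<close>

lemma Q_nonempty: obtains q where "q \<in> Q"
proof -
  have "5 dvd divisor_sum N"
    using sigma twentyfive_dvd by presburger
  then obtain q where "q \<in> prime_factors N" "[q = 1] (mod 5)" "5 dvd Suc (multiplicity q N)"
    by (rule dvd_sigma_obtain[of 5 2, rotated 2]) simp_all
  then show thesis
    using PI that by (auto simp: Q_def)
qed

lemma geo_5_dvd_sigma:
  assumes q: "q \<in> Q"
  shows "geo q 5 dvd divisor_sum N"
proof -
  obtain k where "Suc (multiplicity q N) = 5 * k"
    using q by (auto simp: Q_def)
  then have "geo q 5 dvd geo q (Suc (multiplicity q N))"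
    by (simp only: geo_mult dvd_triv_left)
  then show ?thesis
    using geo_dvd_sigma q Q_subset_P P_subset by (blast intro: dvd_trans)
qed

text \<open>Here \<open>x\<close> is arbitrary rather than prime, so that \<open>x = q ^ 5\<close>
  is covered as well.\<close>

lemma prime_dvd_geo_5_in_P:
  assumes "x > 0" and dvd: "geo x 5 dvd divisor_sum N" and r: "prime r" "r dvd geo x 5" "r \<noteq> 5"
  shows "r \<in> P"
proof -
  have "[r = 1] (mod 5)"
    using assms by (intro prime_dvd_geo_5) auto
  moreover from this have "r \<noteq> 3"
    by (auto simp: cong_def)
  then have "r \<in> prime_factors N"
    using r dvd by (intro dvd_sigma_imp) (auto intro: dvd_trans)
  ultimately show ?thesis
    by (intro PI)
qed

lemma P_gt_1: "p \<in> P \<Longrightarrow> p > 1"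
  using gt_1 P_subset by blast

lemma ex_prime_in_P:
  assumes "geo x 5 dvd divisor_sum N" "[x = 1] (mod 5)" "x > 1"
  obtains r where "r \<in> P" "r dvd geo x 5" "r \<noteq> 5"
proof -
  obtain r where r: "prime r" "r dvd geo x 5" "r \<noteq> 5"
    using ex_prime_dvd_geo_5[OF assms(2,3)] by blast
  have "x > 0"
    using assms(3) by simp
  then have "r \<in> P"
    using assms(1) r by (rule prime_dvd_geo_5_in_P)
  then show thesis
    using r that by blast
qed

lemma not_dvd_geo_5: "x > 1 \<Longrightarrow> \<not> x dvd geo x 5"
proof
  assume "x > 1" "x dvd geo x 5"
  moreover have "x dvd x + x ^ 2 + x ^ 3 + x ^ 4"
    by (intro dvd_add) (auto simp: dvd_power)
  ultimately have "x dvd 1"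
    unfolding geo_5 by (metis add.assoc dvd_add_left_iff)
  then show False
    using \<open>x > 1\<close> by simp
qed

lemma card_P_ge_2: "card P \<ge> 2"
proof -
  obtain q where q: "q \<in> Q"
    by (rule Q_nonempty)
  then have qP: "q \<in> P" using Q_subset_P by blast
  obtain r where r: "r \<in> P" "r dvd geo q 5"
    using ex_prime_in_P[OF geo_5_dvd_sigma[OF q] P_cong_5[OF qP] P_gt_1[OF qP]] by blast
  have "r \<noteq> q"
    using r not_dvd_geo_5 P_gt_1[OF qP] by blast
  then have "card {q, r} = 2"
    by simp
  moreover have "{q, r} \<subseteq> P"
    using r qP by blast
  ultimately show ?thesis
    using card_mono[OF finite_P] by metis
qed

text \<open>Both \<open>geo q 5\<close> and \<open>geo (q ^ 5) 5\<close> divide \<sigma>(N). Each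
  supplies a prime in \<open>P\<close> other than \<open>q\<close>, and these differ because the two
  sums share no prime except possibly 5.\<close>

lemma card_P_ge_3_of_25_dvd:
  assumes qP: "q \<in> P" and dvd: "25 dvd Suc (multiplicity q N)"
  shows "card P \<ge> 3"
proof -
  have q1: "q > 1"
    using qP by (rule P_gt_1)
  obtain k where "Suc (multiplicity q N) = 25 * k"
    using dvd by blast
  then have k: "Suc (multiplicity q N) = (5 * 5) * k"
    by simp
  have "geo q (Suc (multiplicity q N)) dvd divisor_sum N"
    using qP P_subset by (intro geo_dvd_sigma) blast
  then have "geo q 5 * geo (q ^ 5) 5 dvd divisor_sum N"
    unfolding k geo_mult using dvd_mult_left by blast
  then have dvds: "geo q 5 dvd divisor_sum N" "geo (q ^ 5) 5 dvd divisor_sum N"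
    using dvd_mult_left dvd_mult_right by blast+
  have cong: "[q ^ 5 = 1] (mod 5)"
    using cong_pow[OF P_cong_5[OF qP], of 5] by simp
  have q5: "q ^ 5 > 1"
    using q1 by (intro one_less_power) simp_all
  obtain r where r: "r \<in> P" "r dvd geo q 5" "r \<noteq> 5"
    using ex_prime_in_P[OF dvds(1) P_cong_5[OF qP] q1] by blast
  obtain s where s: "s \<in> P" "s dvd geo (q ^ 5) 5" "s \<noteq> 5"
    using ex_prime_in_P[OF dvds(2) cong q5] by blast
  have "r \<noteq> q"
    using r not_dvd_geo_5 q1 by blast
  have prime: "prime r"
    using r P_subset prime_dvd_N by blast
  have "s \<noteq> q"
  proof
    assume "s = q"
    then have "[geo (q ^ 5) 5 = geo 0 5] (mod q)"
      by (intro geo_cong) (simp add: cong_0_iff)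
    then have "q dvd 1"
      using s \<open>s = q\<close> by (simp add: geo_5 cong_dvd_iff)
    then show False
      using q1 by simp
  qed
  have "r \<noteq> s"
  proof
    assume "r = s"
    \<comment> \<open>A common prime \<open>r\<close> would give \<open>q ^ 5 = 1\<close>, hence
      \<open>geo (q ^ 5) 5 = 5\<close>, modulo \<open>r\<close>.\<close>
    have "[q ^ 5 = 1 + (q - 1) * geo q 5] (mod r)"
      using power_eq_geo[of q 5] q1 by simp
    then have "[q ^ 5 = 1] (mod r)"
      using r(2) by (metis cong_0_iff cong_add_lcancel_0_nat cong_trans dvd_mult)
    then have "[geo (q ^ 5) 5 = 5] (mod r)"
      by (rule geo_cong_1)
    then have "r dvd 5"
      using s \<open>r = s\<close> by (simp add: cong_dvd_iff)
    then show False
      using prime r(3) primes_dvd_imp_eq[of r 5] by simp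
  qed
  have "card {q, r, s} = 3"
    using \<open>r \<noteq> q\<close> \<open>s \<noteq> q\<close> \<open>r \<noteq> s\<close> by simp
  moreover have "{q, r, s} \<subseteq> P"
    using r s qP by blast
  ultimately show ?thesis
    using card_mono[OF finite_P] by metis
qed

text \<open>An exponent of 5 other than 2 is at least 4, so \<open>5 ^ 3\<close> divides
  \<sigma>(N). Unless the preceding lemma applies, each prime in \<open>P\<close> contributes at
  most one of these factors 5 and other primes contribute none.\<close>

lemma card_P_ge_3_of_multiplicity:
  assumes mult: "multiplicity 5 N \<noteq> 2"
  shows "card P \<ge> 3"
proof (cases "\<exists>q\<in>P. 25 dvd Suc (multiplicity q N)")
  case True
  then show ?thesis using card_P_ge_3_of_25_dvd by blast
next
  case False
  let ?g = "\<lambda>p. geo p (Suc (multiplicity p N))"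
  have "multiplicity 5 N \<ge> 4"
    using mult multiplicity_ge_2[OF five_in] even_multiplicity[OF five_in] by presburger
  then have "5 ^ 4 dvd N"
    by (rule multiplicity_dvd')
  then obtain m where "N = 5 ^ 4 * m"
    by blast
  then have "divisor_sum N = 5 ^ 3 * (9 * m)"
    using sigma by simp
  then have "5 ^ 3 dvd divisor_sum N"
    by (rule dvdI)
  moreover have "divisor_sum N \<noteq> 0"
    using sigma N_gt_10 by auto
  ultimately have "3 \<le> multiplicity 5 (divisor_sum N)"
    by (intro multiplicity_geI) auto
  also have "\<dots> = (\<Sum>p\<in>prime_factors N. multiplicity 5 (?g p))"
    using \<open>divisor_sum N \<noteq> 0\<close> unfolding divisor_sum_N
    by (intro prime_elem_multiplicity_prod_distrib) auto
  also have "\<dots> \<le> (\<Sum>p\<in>prime_factors N. if p \<in> P then 1 else 0)"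
  proof (rule sum_mono)
    fix p assume p: "p \<in> prime_factors N"
    show "multiplicity 5 (?g p) \<le> (if p \<in> P then 1 else 0)"
    proof (cases "5 dvd ?g p")
      case True
      then have p5: "[p = 1] (mod 5)" "5 dvd Suc (multiplicity p N)"
        using dvd_geo_imp[of 5 2, OF _ _ p] by simp_all
      then have "p \<in> P"
        using p PI by blast
      obtain k where k: "Suc (multiplicity p N) = 5 * k"
        using p5(2) by blast
      \<comment> \<open>Otherwise 25 would divide \<open>e + 1\<close>, against the case
        assumption.\<close>
      have "\<not> 5 dvd k"
        using k False \<open>p \<in> P\<close> by auto
      moreover have "[geo (p ^ 5) k = k] (mod 5)"
        using cong_pow[OF p5(1), of 5] by (intro geo_cong_1) simp
      ultimately have nk: "\<not> 5 dvd geo (p ^ 5) k"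
        using cong_dvd_iff by blast
      obtain u where u: "geo p 5 = 5 * u" "\<not> 5 dvd u"
        using geo_5_eq_5_mult[OF p5(1)] .
      have "\<not> 5 dvd u * geo (p ^ 5) k"
        using nk u(2) prime_dvd_mult_iff[of "5 :: nat"] by simp
      then have "\<not> 5 * 5 dvd 5 * (u * geo (p ^ 5) k)"
        by simp
      then have "\<not> 5 ^ 2 dvd ?g p"
        unfolding k geo_mult u(1) power2_eq_square mult.assoc .
      then show ?thesis
        using \<open>p \<in> P\<close> multiplicity_le_1I[of 5 "?g p"] by simp
    next
      case False
      then show ?thesis
        by (simp add: not_dvd_imp_multiplicity_0)
    qed
  qed
  also have "\<dots> = card (prime_factors N \<inter> P)"
    by (subst sum.inter_restrict[symmetric]) auto
  also have "prime_factors N \<inter> P = P"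
    using P_subset by blast
  finally show ?thesis .
qed

text \<open>1 + 5 + 25 = 31 divides \<sigma>(N).\<close>

lemma thirty_one_in_P:
  assumes "multiplicity 5 N = 2"
  shows "31 \<in> P"
proof -
  have "31 dvd divisor_sum N"
    using geo_dvd_sigma[OF five_in] assms by (simp add: geo_3)
  then show ?thesis
    by (intro PI dvd_sigma_imp) (auto simp: cong_def)
qed

section \<open>Size constraints on at most six prime factors\<close>

lemma prod_euler_factor_ge: "9 / 5 \<le> (\<Prod>p\<in>prime_factors N. euler_factor p)"
proof -
  have "5 * real (divisor_sum N) = 9 * real N"
    using sigma by linarith
  then have "real N * (9 / 5) \<le> real N * (\<Prod>p\<in>prime_factors N. euler_factor p)"
    using divisor_sum_le_prod_euler_factor[of N] N_gt_10 by linarith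
  then show ?thesis
    using N_gt_10 by simp
qed

lemma prod_euler_factor_le:
  assumes "U \<subseteq> prime_factors N" "finite T" "card U \<le> card T"
    and "\<And>x y. x \<in> U - T \<Longrightarrow> y \<in> T \<Longrightarrow> y \<le> x" and "\<And>y. y \<in> T \<Longrightarrow> 1 < y"
  shows "(\<Prod>p\<in>U. euler_factor p) \<le> (\<Prod>p\<in>T. euler_factor p)"
proof (rule prod_le_prod_of_card_le)
  show "finite U"
    using assms(1) finite_subset by blast
  have gt: "1 < y" if "y \<in> U \<union> T" for y
    using that assms(1,5) gt_1 by blast
  show "euler_factor x \<le> euler_factor y" if "y \<in> U \<union> T" "y \<le> x" for x y
    using gt that euler_factor_mono by blast
  show "1 \<le> euler_factor x" if "x \<in> U \<union> T" for x
    using gt that euler_factor_ge_1 by blast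
qed (use assms in auto)

lemma ex_prime_factor_in_P:
  assumes q: "q \<in> Q" and v: "v dvd geo q 5" "1 < v"
  shows "\<exists>r\<in>insert 5 P. r dvd v"
proof -
  obtain r where r: "prime r" "r dvd v"
    using v(2) prime_factor_nat[of v] by auto
  have "q > 0"
    using q P_gt_1 Q_subset_P by force
  then have "r \<in> P" if "r \<noteq> 5"
    using prime_dvd_geo_5_in_P[OF _ geo_5_dvd_sigma[OF q] r(1)] dvd_trans[OF r(2) v(1)] that by blast
  then show ?thesis
    using r(2) by blast
qed

lemma P_cases: "p \<in> P \<Longrightarrow> p mod 10 = 1 \<and> \<not> 3 dvd p \<and> 1 < p"
  using not_three_dvd gt_1 by (auto simp: P_def cong_def)

lemma factor_cases: "p \<in> prime_factors N \<Longrightarrow> odd p \<and> \<not> 3 dvd p \<and> 1 < p"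
  using odd_dvd not_three_dvd gt_1 by blast

text \<open>Between 1 and 23, coprimality to 6 already leaves only primes.\<close>

lemma small_factor_cases:
  assumes "p \<in> prime_factors N" "p < 23"
  shows "p \<in> {5, 7, 11, 13, 17, 19}"
proof -
  have "p = 5 \<or> p = 7 \<or> p = 11 \<or> p = 13 \<or> p = 17 \<or> p = 19"
    using factor_cases[OF assms(1)] assms(2) by presburger
  then show ?thesis by simp
qed

text \<open>The candidate 21 is a multiple of 3.\<close>

lemma P_ge_31: "p \<in> P \<Longrightarrow> p \<noteq> 11 \<Longrightarrow> 31 \<le> p"
  using P_cases[of p] by presburger

lemma P_less: "p \<in> P \<Longrightarrow> q \<in> P \<Longrightarrow> p < q \<Longrightarrow> p + 10 \<le> q"
proof -
  assume "p \<in> P" "q \<in> P" "p < q"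
  moreover from this have "p mod 10 = 1" "q mod 10 = 1"
    using P_cases by blast+
  then obtain i j where "p = 10 * i + 1" "q = 10 * j + 1"
    by (metis div_mod_decomp mult.commute)
  ultimately show ?thesis
    by simp
qed

text \<open>Without 7 the best case is 5, 11, 13, 17, 19, 23, whose product stays below 9/5.\<close>

lemma seven_in:
  assumes six: "card (prime_factors N) \<le> 6"
  shows "7 \<in> prime_factors N"
proof (rule ccontr)
  assume no: "7 \<notin> prime_factors N"
  let ?T = "{5, 11, 13, 17, 19, 23} :: nat set"
  have ge: "23 \<le> x" if "x \<in> prime_factors N - ?T" for x
    using small_factor_cases[of x] that no by (cases "x < 23") auto
  have "(\<Prod>p\<in>prime_factors N. euler_factor p) \<le> (\<Prod>p\<in>?T. euler_factor p)"
  proof (rule prod_euler_factor_le)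
    show "y \<le> x" if "x \<in> prime_factors N - ?T" "y \<in> ?T" for x y
      using ge[OF that(1)] that(2) by auto
  qed (use six in auto)
  then show False
    using prod_euler_factor_ge by (simp add: euler_factor_def)
qed

text \<open>Without 11 two elements of \<open>P\<close> are at least 31 and 41. The other primes are
  at best 5, 7, 13, 17, and the product stays below 9/5.\<close>

lemma eleven_in:
  assumes six: "card (prime_factors N) \<le> 6"
  shows "11 \<in> P"
proof (rule ccontr)
  assume no: "11 \<notin> P"
  obtain y z where yz: "y \<in> P" "z \<in> P" "y < z"
    using obtain_two_of_card[OF card_P_ge_2] .
  have y: "31 \<le> y"
    using P_ge_31 yz no by metis
  then have z: "41 \<le> z"
    using P_less yz by force
  have sub: "{y, z} \<subseteq> prime_factors N"
    using yz P_subset by blast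
  let ?T = "{5, 7, 13, 17} :: nat set" and ?U = "prime_factors N - {y, z}"
  have ge: "17 \<le> x" if "x \<in> ?U - ?T" for x
  proof -
    have "x \<noteq> 11"
      using that no by (auto simp: P_def cong_def)
    then show ?thesis
      using small_factor_cases[of x] that by (cases "x < 23") auto
  qed
  have "card ?U \<le> 4"
    using six sub yz(3) by (subst card_Diff_subset) auto
  then have U: "(\<Prod>p\<in>?U. euler_factor p) \<le> (\<Prod>p\<in>?T. euler_factor p)"
  proof (intro prod_euler_factor_le)
    show "b \<le> a" if "a \<in> ?U - ?T" "b \<in> ?T" for a b
      using ge[OF that(1)] that(2) by auto
  qed auto
  have "(\<Prod>p\<in>prime_factors N. euler_factor p) = (\<Prod>p\<in>?U. euler_factor p) * (\<Prod>p\<in>{y, z}. euler_factor p)"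
    using sub by (intro prod.subset_diff) auto
  also have "\<dots> = (\<Prod>p\<in>?U. euler_factor p) * (euler_factor y * euler_factor z)"
    using yz(3) by simp
  also have "\<dots> \<le> (\<Prod>p\<in>?T. euler_factor p) * (euler_factor 31 * euler_factor 41)"
    using U y z by (intro mult_mono euler_factor_mono mult_nonneg_nonneg prod_nonneg less_imp_le[OF euler_factor_pos]) auto
  finally show False
    using prod_euler_factor_ge by (simp add: euler_factor_def)
qed

text \<open>Otherwise the exponent of 5 is 2 and \<open>P = {11, 31}\<close>, but
  \<open>geo 11 5\<close> and \<open>geo 31 5\<close> both have prime factors outside 5, 11,
  31.\<close>

lemma card_P_ge_3:
  assumes six: "card (prime_factors N) \<le> 6"
  shows "card P \<ge> 3"
proof (rule ccontr)
  assume no: "\<not> card P \<ge> 3"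
  then have "multiplicity 5 N = 2"
    using card_P_ge_3_of_multiplicity by blast
  then have "{11, 31} \<subseteq> P"
    using thirty_one_in_P eleven_in[OF six] by blast
  moreover have "card P \<le> card {11, 31 :: nat}"
    using no by simp
  ultimately have P: "{11, 31} = P"
    using finite_P by (intro card_seteq)
  obtain q where q: "q \<in> Q"
    by (rule Q_nonempty)
  then have "q \<in> {11, 31}"
    using P Q_subset_P by blast
  have "\<exists>v. v dvd geo q 5 \<and> 1 < v \<and> (\<forall>r\<in>{5, 11, 31}. \<not> r dvd v)"
    using \<open>q \<in> {11, 31}\<close>
  proof
    assume "q = 11"
    then show ?thesis
      by (intro exI[of _ 3221]) (simp add: geo_5)
  next
    assume "q \<in> {31}"
    then show ?thesis
      by (intro exI[of _ 17351]) (simp add: geo_5)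
  qed
  then show False
    using ex_prime_factor_in_P[OF q] P by blast
qed

section \<open>The finitely many remaining cases\<close>

lemma small_prime_factors:
  assumes six: "card (prime_factors N) \<le> 6"
  obtains y z where "P = {11, y, z}" "y = 31 \<and> z \<le> 421 \<or> y = 41 \<and> z \<le> 91" "y < z"
proof -
  let ?f = euler_factor
  have "2 \<le> card (P - {11})"
    using card_P_ge_3[OF six] eleven_in[OF six] finite_P by (subst card_Diff_singleton) auto
  then obtain y z where yz: "y \<in> P - {11}" "z \<in> P - {11}" "y < z"
    by (rule obtain_two_of_card)
  have y: "31 \<le> y"
    using P_ge_31 yz by blast
  have z: "y + 10 \<le> z"
    using P_less yz by blast
  let ?A = "{5, 7, 11, y, z}" and ?S = "prime_factors N"
  have A: "?A \<subseteq> ?S"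
    using five_in seven_in[OF six] eleven_in[OF six] yz P_subset by blast
  have cardA: "card ?A = 5"
    using y z by simp
  \<comment> \<open>77/48 = 5/4 * 7/6 * 11/10 collects the primes 5, 7 and 11.\<close>
  have prodA: "(\<Prod>p\<in>?A. ?f p) = 77 / 48 * (?f y * ?f z)"
    using y z by (simp add: euler_factor_def)
  have split: "(\<Prod>p\<in>?S. ?f p) = (\<Prod>p\<in>?S - ?A. ?f p) * (77 / 48 * (?f y * ?f z))"
    using A unfolding prodA[symmetric] by (intro prod.subset_diff) auto
  have card: "card (?S - ?A) \<le> 1"
    using six A cardA by (subst card_Diff_subset) auto
  have fy: "0 \<le> ?f y" "0 \<le> ?f z"
    using y z by (intro less_imp_le[OF euler_factor_pos]; simp)+
  have bound: "?f y * ?f z \<le> ?f a * ?f b" if "1 < a" "a \<le> y" "1 < b" "b \<le> z" for a b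
    using that fy by (intro mult_mono euler_factor_mono less_imp_le[OF euler_factor_pos]) auto
  have "?S - ?A \<noteq> {}"
  proof
    assume "?S - ?A = {}"
    then have "9 / 5 \<le> 77 / 48 * (?f y * ?f z)"
      using prod_euler_factor_ge unfolding split by (simp only: prod.empty mult_1)
    also have "\<dots> \<le> 77 / 48 * (?f 31 * ?f 41)"
      using y z by (intro mult_left_mono bound) auto
    finally show False
      by (simp add: euler_factor_def)
  qed
  then have "card (?S - ?A) = 1"
    using card by (simp add: card_gt_0_iff le_antisym Suc_le_eq)
  then obtain w where w: "?S - ?A = {w}"
    using card_1_singletonE by blast
  then have wS: "w \<in> ?S" "w \<notin> ?A"
    by blast+
  have key: "9 / 5 \<le> ?f w * (77 / 48 * (?f y * ?f z))"
    using prod_euler_factor_ge unfolding split w by simp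
  have le: "9 / 5 \<le> ?f c * (77 / 48 * (?f a * ?f b))"
    if "1 < a" "a \<le> y" "1 < b" "b \<le> z" "1 < c" "c \<le> w" for a b c
  proof -
    have "?f w * (77 / 48 * (?f y * ?f z)) \<le> ?f c * (77 / 48 * (?f a * ?f b))"
      using that fy by (intro mult_mono[OF euler_factor_mono mult_left_mono[OF bound]]
          mult_nonneg_nonneg less_imp_le[OF euler_factor_pos]) auto
    with key show ?thesis by linarith
  qed
  have w13: "13 \<le> w"
    using small_factor_cases[OF wS(1)] wS(2) by (cases "w < 23") auto
  \<comment> \<open>The sixth prime \<open>w\<close> must bring the product up to 9/5. Even with the
    smallest \<open>y = 31\<close>, \<open>z = 41\<close>, the value 18 falls short.\<close>
  have w18: "w < 18"
  proof (rule ccontr)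
    assume "\<not> w < 18"
    then show False
      using le[of 31 41 18] y z by (simp add: euler_factor_def)
  qed
  have P: "P = {11, y, z}"
  proof
    show "{11, y, z} \<subseteq> P"
      using eleven_in[OF six] yz by blast
    show "P \<subseteq> {11, y, z}"
    proof
      fix p assume p: "p \<in> P"
      show "p \<in> {11, y, z}"
      proof (rule ccontr)
        assume n: "p \<notin> {11, y, z}"
        then have "31 \<le> p"
          using p P_ge_31 by blast
        then have "p \<in> ?S - ?A"
          using n p P_subset by auto
        then show False
          using w w18 \<open>31 \<le> p\<close> by simp
      qed
    qed
  qed
  \<comment> \<open>The three remaining bounds use \<open>w \<ge> 13\<close>; here
    \<open>z \<ge> y + 10\<close> supplies 71. The value \<open>y = 51\<close> survives this bound
    and falls only to divisibility by 3.\<close>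
  have "y < 61"
  proof (rule ccontr)
    assume "\<not> y < 61"
    then show False
      using le[of 61 71 13] z w13 by (simp add: euler_factor_def)
  qed
  then have y_cases: "y = 31 \<or> y = 41"
  proof -
    have "y mod 10 = 1" "\<not> 3 dvd y"
      using P_cases yz(1) by blast+
    then obtain a where a: "y = 10 * a + 1"
      by (metis div_mod_decomp mult.commute)
    then have "a = 3 \<or> a = 4 \<or> a = 5"
      using y \<open>y < 61\<close> by auto
    then show ?thesis
      using a \<open>\<not> 3 dvd y\<close> by auto
  qed
  have z31: "z < 431" if "y = 31"
  proof (rule ccontr)
    assume "\<not> z < 431"
    then show False
      using le[of 31 431 13] y w13 by (simp add: euler_factor_def)
  qed
  have z41: "z < 101" if "y = 41"
  proof (rule ccontr)
    assume "\<not> z < 101"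
    then show False
      using le[of 41 101 13] that w13 by (simp add: euler_factor_def)
  qed
  have "y = 31 \<and> z \<le> 421 \<or> y = 41 \<and> z \<le> 91"
  proof -
    have "z mod 10 = 1"
      using P_cases yz(2) by blast
    then have "z < 431 \<Longrightarrow> z \<le> 421" "z < 101 \<Longrightarrow> z \<le> 91"
      by presburger+
    then show ?thesis
      using y_cases z31 z41 by blast
  qed
  then show thesis
    using that P yz(3) by blast
qed

lemma card_prime_factors_ge_7: "7 \<le> card (prime_factors N)"
proof (rule ccontr)
  assume "\<not> 7 \<le> card (prime_factors N)"
  then have six: "card (prime_factors N) \<le> 6"
    by simp
  obtain y z where P: "P = {11, y, z}" and yz: "y = 31 \<and> z \<le> 421 \<or> y = 41 \<and> z \<le> 91" "y < z"
    using small_prime_factors[OF six] .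
  obtain q where q: "q \<in> Q"
    by (rule Q_nonempty)
  then have q_cases: "q \<in> {11, y, z}"
    using Q_subset_P P by blast
  have no: "\<not> excludes y z q v" for v
    using ex_prime_factor_in_P[OF q, of v] unfolding P excludes_def by blast
  have "z mod 10 = 1"
    using P_cases[of z] P by simp
  then obtain k where k: "z = 10 * k + 1"
    by (metis div_mod_decomp mult.commute)
  show False
    using yz(1)
  proof
    assume *: "y = 31 \<and> z \<le> 421"
    \<comment> \<open>The table lists every \<open>z = 10 * k + 1\<close> from 41 to 421, so
      expanding the interval of \<open>k\<close> finds the entry.\<close>
    have "k \<in> set [4..<43]"
      unfolding set_upt using * yz(2) k by simp
    then have "z \<in> fst ` set cofactors_31"
      unfolding k cofactors_31_def by auto
    then obtain u where "(z, u) \<in> set cofactors_31"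
      by auto
    then show False
      using excludes_31 no q_cases * by blast
  next
    assume *: "y = 41 \<and> z \<le> 91"
    have "k \<in> set [5..<10]"
      unfolding set_upt using * yz(2) k by simp
    then have "z \<in> fst ` set cofactors_41"
      unfolding k cofactors_41_def by auto
    then obtain u where "(z, u) \<in> set cofactors_41"
      by auto
    then show False
      using excludes_41 no q_cases * by blast
  qed
qed

end

theorem theorem1p2:
  fixes N :: nat
  assumes "friend_of_10 N"
  shows "card (prime_factors N) \<ge> 7 \<and>
    (\<exists>p \<in> prime_factors N. \<exists>q \<in> prime_factors N. [p = 1] (mod 10) \<and> [q = 1] (mod 6))"
proof -
  interpret friend_of_ten N
    using assms by (rule friend_of_ten.intro)
  have "\<exists>p\<in>prime_factors N. [p = 1] (mod 10)"
    using Q_nonempty Q_subset_P by (auto simp: P_def)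
  then show ?thesis
    using card_prime_factors_ge_7 ex_cong_1_mod_6 by blast
qed

end
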